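(* The $q$-quasi-shuffle product $\star_{\mathrm{qs}}$ on $\mathbb Q\langle\widetilde Y\rangle$ is commutative and associative. Moreover, for any $u,v\in\widetilde Y^*$, $$\bar{\mathfrak z}_q^{\mathrm{qs}}(u)\;\bar{\mathfrak z}_q^{\mathrm{qs}}(v)=\bar{\mathfrak z}_q^{\mathrm{qs}}(u\star_{\mathrm{qs}}v).$$
   Context: Modified $q$-multiple zeta values: for $k\ge1$ and $n_1,\dots,n_k\in\mathbb Z$, $$\bar{\mathfrak z}_q(n_1,\dots,n_k)=\sum_{m_1>\cdots>m_k>0}\frac{q^{m_1}}{(1-q^{m_1})^{n_1}\cdots(1-q^{m_k})^{n_k}},$$ an element of $q\,\mathbb Q[[q]]$ (the series also converges for every complex $q$ with $|q|<1$). $\widetilde Y=\{z_n:\ n\in\mathbb Z\}$ is an alphabet, $\widetilde Y^*$ the set of words on it (including the empty word $\mathbf 1$), and $\mathbb Q\langle\widetilde Y\rangle$ the $\mathbb Q$-vector space with basis $\widetilde Y^*$. The internal product on letters is $[z_iz_j]=z_{i+j}$. The ordinary quasi-shuffle product $*$ is the bilinear product with unit $\mathbf 1$ defined recursively by $av*bv'=a(v*bv')+b(av*v')+[ab](v*v')$ for letters $a,b$ and words $v,v'$. The injective linear operator $T$ on $\mathbb Q\langle\widetilde Y\rangle$ is $T(\mathbf 1)=\mathbf 1$, $T(z_nv)=z_nv-z_{n-1}v$. The $q$-quasi-shuffle product $\star_{\mathrm{qs}}$ (denoted by a shuffle symbol with a bar in the source) is the bilinear product with unit $\mathbf 1$ characterized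 by $T(u\star_{\mathrm{qs}}v)=T(u)*T(v)$; explicitly, for $m,n\in\mathbb Z$ and words $u,v$, $$z_mu\star_{\mathrm{qs}}z_nv=z_m\big(u*T(z_nv)\big)+z_n\big(T(z_mu)*v\big)+(z_{m+n}-z_{m+n-1})(u*v).$$ The $\mathbb Q$-linear map $\bar{\mathfrak z}_q^{\mathrm{qs}}:\mathbb Q\langle\widetilde Y\rangle\to\mathbb Q[[q]]$ is given by $\bar{\mathfrak z}_q^{\mathrm{qs}}(z_{n_1}\cdots z_{n_k})=\bar{\mathfrak z}_q(n_1,\dots,n_k)$ and $\bar{\mathfrak z}_q^{\mathrm{qs}}(\mathbf 1)=1$. *)

theory Defs
  imports "HOL-Analysis.Analysis" "HOL-Library.Poly_Mapping"
begin

section \<open>The free rational vector space on words\<close>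

text \<open>
  The letter \<open>z\<^sub>n\<close> is represented by the integer \<open>n\<close>, so that the word
  \<open>z\<^sub>n\<^sub>1 \<dots> z\<^sub>n\<^sub>k\<close> is the list \<open>[n\<^sub>1, \<dots>, n\<^sub>k]\<close> and the internal product of letters is
  addition of integers.
\<close>

type_synonym zword = "int list"

type_synonym qwords = "zword \<Rightarrow>\<^sub>0 rat"

abbreviation wd :: "zword \<Rightarrow> qwords" where
  "wd w \<equiv> Poly_Mapping.single w 1"

definition scl :: "rat \<Rightarrow> qwords \<Rightarrow> qwords" where
  "scl c x = Poly_Mapping.map ((*) c) x"

definition lin :: "(zword \<Rightarrow> qwords) \<Rightarrow> qwords \<Rightarrow> qwords" where
  "lin f x = (\<Sum>w\<in>Poly_Mapping.keys x. scl (Poly_Mapping.lookup x w) (f w))"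

definition bilin :: "(zword \<Rightarrow> zword \<Rightarrow> qwords) \<Rightarrow> qwords \<Rightarrow> qwords \<Rightarrow> qwords" where
  "bilin f x y = lin (\<lambda>u. lin (\<lambda>v. f u v) y) x"

definition prep :: "int \<Rightarrow> qwords \<Rightarrow> qwords" where
  "prep n = lin (\<lambda>w. wd (n # w))"

section \<open>The products\<close>

fun qsh_word :: "zword \<Rightarrow> zword \<Rightarrow> qwords" where
  "qsh_word [] v = wd v"
| "qsh_word u [] = wd u"
| "qsh_word (a # v) (b # v') =
     prep a (qsh_word v (b # v')) + prep b (qsh_word (a # v) v') + prep (a + b) (qsh_word v v')"

definition qsh :: "qwords \<Rightarrow> qwords \<Rightarrow> qwords" where
  "qsh = bilin qsh_word"

fun T_word :: "zword \<Rightarrow> qwords" where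
  "T_word [] = wd []"
| "T_word (n # v) = wd (n # v) - wd ((n - 1) # v)"

definition T_op :: "qwords \<Rightarrow> qwords" where
  "T_op = lin T_word"

text \<open>
  The \<open>q\<close>-quasi-shuffle product is defined by its explicit formula on words. The lemmas
  \<open>T_op_qqsh\<close> and \<open>inj_T_op\<close> below show that it is the unique operation satisfying
  \<open>T (u \<star> v) = T u * T v\<close>, where \<open>*\<close> is the ordinary quasi-shuffle product.
\<close>

fun qqsh_word :: "zword \<Rightarrow> zword \<Rightarrow> qwords" where
  "qqsh_word [] v = wd v"
| "qqsh_word u [] = wd u"
| "qqsh_word (m # u) (n # v) =
     prep m (qsh (wd u) (T_op (wd (n # v)))) + prep n (qsh (T_op (wd (m # u))) (wd v))
     + (prep (m + n) (qsh (wd u) (wd v)) - prep (m + n - 1) (qsh (wd u) (wd v)))"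

definition qqsh :: "qwords \<Rightarrow> qwords \<Rightarrow> qwords" (infixl \<open>\<star>\<close> 70) where
  "qqsh = bilin qqsh_word"

section \<open>Modified q-multiple zeta values\<close>

text \<open>
  Values are formal power series in \<open>q = fps_X\<close>. The infinite sum is taken in the \<open>q\<close>-adic
  topology of \<open>rat fps\<close>; it converges by lemma \<open>summable_qmzv\<close> below.
\<close>

definition mzv_indices :: "nat \<Rightarrow> nat list set" where
  "mzv_indices k = {ms. length ms = k \<and> sorted_wrt (>) ms \<and> (\<forall>m\<in>set ms. m > 0)}"

definition qmzv_term :: "int list \<Rightarrow> nat list \<Rightarrow> rat fps" where
  "qmzv_term ns ms =
     fps_X ^ hd ms / (\<Prod>i<length ns. (1 - fps_X ^ (ms ! i)) powi (ns ! i))"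

definition qmzv :: "int list \<Rightarrow> rat fps" where
  "qmzv ns = (\<Sum>\<^sub>\<infinity>ms\<in>mzv_indices (length ns). qmzv_term ns ms)"

definition qmzv_word :: "zword \<Rightarrow> rat fps" where
  "qmzv_word w = (if w = [] then 1 else qmzv w)"

definition qmzv_qs :: "qwords \<Rightarrow> rat fps" where
  "qmzv_qs x = (\<Sum>w\<in>Poly_Mapping.keys x. fps_const (Poly_Mapping.lookup x w) * qmzv_word w)"

section \<open>Well-definedness\<close>

lemma lookup_scl: "Poly_Mapping.lookup (scl c x) w = c * Poly_Mapping.lookup x w"
  by (simp add: scl_def Poly_Mapping.map.rep_eq when_def)

lemma lookup_lin_superset:
  assumes "finite A" "Poly_Mapping.keys x \<subseteq> A"
  shows "Poly_Mapping.lookup (lin f x) w =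
    (\<Sum>u\<in>A. Poly_Mapping.lookup x u * Poly_Mapping.lookup (f u) w)"
  unfolding lin_def lookup_sum lookup_scl
  by (rule sum.mono_neutral_left) (use assms in \<open>auto simp: in_keys_iff\<close>)

lemmas lookup_lin = lookup_lin_superset[OF finite_keys order.refl]

lemma lin_single [simp]: "lin f (wd w) = f w"
  by (rule poly_mapping_eqI) (simp add: lookup_lin)

lemma lin_add: "lin f (x + y) = lin f x + lin f y"
proof (rule poly_mapping_eqI)
  fix w
  let ?A = "Poly_Mapping.keys x \<union> Poly_Mapping.keys y"
  show "Poly_Mapping.lookup (lin f (x + y)) w = Poly_Mapping.lookup (lin f x + lin f y) w"
    by (simp add: lookup_add lookup_lin_superset[where A = ?A] Poly_Mapping.keys_add
        sum.distrib distrib_right)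
qed

lemma lin_diff: "lin f (x - y) = lin f x - lin f y"
  using lin_add[of f "x - y" y] by (simp add: algebra_simps)

lemma lin_zero [simp]: "lin f 0 = 0"
  by (simp add: lin_def)

lemma lin_sum: "lin f (sum g A) = (\<Sum>a\<in>A. lin f (g a))"
  by (induction A rule: infinite_finite_induct) (simp_all add: lin_add)

lemma lin_scl: "lin f (scl c x) = scl c (lin f x)"
proof (rule poly_mapping_eqI)
  fix w
  have "Poly_Mapping.keys (scl c x) \<subseteq> Poly_Mapping.keys x"
    by (auto simp: in_keys_iff lookup_scl)
  then show "Poly_Mapping.lookup (lin f (scl c x)) w = Poly_Mapping.lookup (scl c (lin f x)) w"
    by (simp add: lookup_scl lookup_lin_superset[where A = "Poly_Mapping.keys x"]
        sum_distrib_left mult.assoc)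
qed

lemma lin_lin: "lin g (lin f x) = lin (\<lambda>w. lin g (f w)) x"
  by (simp add: lin_def[of f] lin_def[of "\<lambda>w. lin g (f w)"] lin_sum lin_scl)

lemma lin_swap: "lin (\<lambda>u. lin (\<lambda>v. h u v) y) x = lin (\<lambda>v. lin (\<lambda>u. h u v) x) y"
proof (rule poly_mapping_eqI)
  fix w
  show "Poly_Mapping.lookup (lin (\<lambda>u. lin (\<lambda>v. h u v) y) x) w =
    Poly_Mapping.lookup (lin (\<lambda>v. lin (\<lambda>u. h u v) x) y) w"
    unfolding lookup_lin sum_distrib_left
    by (subst sum.swap) (simp add: mult_ac)
qed

lemma bilin_diff_left: "bilin f (x - x') y = bilin f x y - bilin f x' y"
  by (simp add: bilin_def lin_diff)

lemma bilin_diff_right: "bilin f x (y - y') = bilin f x y - bilin f x y'"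
  unfolding bilin_def lin_swap[where h = f and x = x] by (rule lin_diff)

lemma qsh_wd [simp]: "qsh (wd u) (wd v) = qsh_word u v"
  by (simp add: qsh_def bilin_def)

lemma qqsh_wd [simp]: "wd u \<star> wd v = qqsh_word u v"
  by (simp add: qqsh_def bilin_def)

lemma T_op_wd [simp]: "T_op (wd u) = T_word u"
  by (simp add: T_op_def)

lemmas qsh_diff = bilin_diff_left[of qsh_word, folded qsh_def]
  bilin_diff_right[of qsh_word, folded qsh_def]

lemma T_op_prep: "T_op (prep n x) = prep n x - prep (n - 1) x"
proof (rule poly_mapping_eqI)
  fix w
  show "Poly_Mapping.lookup (T_op (prep n x)) w =
    Poly_Mapping.lookup (prep n x - prep (n - 1) x) w"
    by (simp add: T_op_def prep_def lin_lin lookup_minus lookup_lin sum_subtractf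
        right_diff_distrib)
qed

lemma prep_diff: "prep n (x - y) = prep n x - prep n y"
  by (simp add: prep_def lin_diff)

lemma T_op_add: "T_op (x + y) = T_op x + T_op y"
  and T_op_diff: "T_op (x - y) = T_op x - T_op y"
  by (simp_all add: T_op_def lin_add lin_diff)

lemma qsh_word_Nil2 [simp]: "qsh_word u [] = wd u"
  by (cases u) simp_all

lemma T_op_qqsh_word: "T_op (qqsh_word u v) = qsh (T_word u) (T_word v)"
proof (cases u; cases v)
  fix m u' n v' assume uv: "u = m # u'" "v = n # v'"
  have eq: "m - 1 + (n - 1) = m + n - 1 - 1" "m - 1 + n = m + n - 1" "m + (n - 1) = m + n - 1"
    by simp_all
  show ?thesis
    by (simp add: uv T_op_add T_op_diff T_op_prep qsh_diff prep_diff eq)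
qed (simp_all add: qsh_diff)

lemma T_op_qqsh: "T_op (x \<star> y) = qsh (T_op x) (T_op y)"
proof -
  have "T_op (x \<star> y) = lin (\<lambda>u. lin (\<lambda>v. T_op (qqsh_word u v)) y) x"
    by (simp add: T_op_def qqsh_def bilin_def lin_lin)
  also have "\<dots> = lin (\<lambda>u. lin (\<lambda>v. qsh (T_word u) (T_word v)) y) x"
    by (simp add: T_op_qqsh_word)
  also have "\<dots> = qsh (T_op x) (T_op y)"
    by (simp add: qsh_def bilin_def T_op_def lin_lin lin_swap[where x = "T_word _" and y = y])
  finally show ?thesis .
qed

lemma lookup_T_op_Cons:
  "Poly_Mapping.lookup (T_op x) (n # v) =
    Poly_Mapping.lookup x (n # v) - Poly_Mapping.lookup x ((n + 1) # v)"
proof -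
  let ?A = "insert (n # v) (insert ((n + 1) # v) (Poly_Mapping.keys x))"
  have *: "Poly_Mapping.lookup (T_word u) (n # v) =
      (if u = n # v then 1 else 0) - (if u = (n + 1) # v then 1 else 0)" for u
    by (cases u) (auto simp: lookup_minus lookup_single when_def)
  have "Poly_Mapping.lookup (T_op x) (n # v) =
      (\<Sum>u\<in>?A. Poly_Mapping.lookup x u * Poly_Mapping.lookup (T_word u) (n # v))"
    unfolding T_op_def by (rule lookup_lin_superset) auto
  also have "\<dots> = (\<Sum>u\<in>?A. (if u = n # v then Poly_Mapping.lookup x u else 0)
      - (if u = (n + 1) # v then Poly_Mapping.lookup x u else 0))"
    by (rule sum.cong) (auto simp: *)
  also have "\<dots> = Poly_Mapping.lookup x (n # v) - Poly_Mapping.lookup x ((n + 1) # v)"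
    unfolding sum_subtractf by (subst (1 2) sum.delta) auto
  finally show ?thesis .
qed

lemma lookup_T_op_Nil: "Poly_Mapping.lookup (T_op x) [] = Poly_Mapping.lookup x []"
proof -
  have *: "Poly_Mapping.lookup (T_word u) [] = (if u = [] then 1 else 0)" for u
    by (cases u) (auto simp: lookup_minus lookup_single when_def)
  have "Poly_Mapping.lookup (T_op x) [] =
      (\<Sum>u\<in>insert [] (Poly_Mapping.keys x).
        Poly_Mapping.lookup x u * Poly_Mapping.lookup (T_word u) [])"
    unfolding T_op_def by (rule lookup_lin_superset) auto
  also have "\<dots> = (\<Sum>u\<in>insert [] (Poly_Mapping.keys x).
      if u = [] then Poly_Mapping.lookup x u else 0)"
    by (rule sum.cong) (auto simp: *)
  also have "\<dots> = Poly_Mapping.lookup x []"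
    by (subst sum.delta) auto
  finally show ?thesis .
qed

lemma inj_T_op: "inj T_op"
proof (rule injI)
  fix x y assume eq: "T_op x = T_op y"
  define d where "d = x - y"
  have d0: "T_op d = 0"
    by (simp add: d_def T_op_diff eq)
  have step: "Poly_Mapping.lookup d (n # v) = Poly_Mapping.lookup d ((n + 1) # v)" for n v
    using lookup_T_op_Cons[of d n v] d0 by simp
  have shift: "Poly_Mapping.lookup d (n # v) = Poly_Mapping.lookup d ((n + int k) # v)" for n v k
    by (induction k) (simp_all add: step[of "n + int _"] add_ac)
  have "Poly_Mapping.lookup d w = 0" for w
  proof (cases w)
    case Nil
    then show ?thesis using lookup_T_op_Nil[of d] d0 by simp
  next
    case (Cons n v)
    show ?thesis
    proof (rule ccontr)
      assume "Poly_Mapping.lookup d w \<noteq> 0"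
      then have "range (\<lambda>k. (n + int k) # v) \<subseteq> Poly_Mapping.keys d"
        using shift[of n v] Cons by (auto simp: in_keys_iff)
      moreover have "infinite (range (\<lambda>k. (n + int k) # v))"
        by (rule range_inj_infinite) (auto intro: injI)
      ultimately show False
        using finite_subset finite_keys by blast
    qed
  qed
  then have "d = 0" by (intro poly_mapping_eqI) simp
  then show "x = y" by (simp add: d_def)
qed

lemma qmzv_denom_nth_0:
  assumes "\<And>m. m \<in> set ms \<Longrightarrow> m > 0" "length ms = length ns"
  shows "fps_nth (\<Prod>i<length ns. (1 - fps_X ^ (ms ! i) :: rat fps) powi (ns ! i)) 0 = 1"
proof -
  have "fps_nth ((1 - fps_X ^ m :: rat fps) powi n) 0 = 1" if "m > 0" for m n
    using that by (simp add: power_int_def fps_power_zeroth power_0_left)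
  then have "fps_nth ((1 - fps_X ^ (ms ! i) :: rat fps) powi (ns ! i)) 0 = 1"
    if "i < length ns" for i
    using that assms by simp
  moreover have "fps_nth (prod f A) 0 = (\<Prod>i\<in>A. fps_nth (f i) 0)" for f :: "nat \<Rightarrow> rat fps" and A
    by (induction A rule: infinite_finite_induct) simp_all
  ultimately show ?thesis
    by simp
qed

lemma summable_qmzv:
  assumes "ns \<noteq> []"
  shows "qmzv_term ns summable_on mzv_indices (length ns)"
proof -
  let ?A = "mzv_indices (length ns)"
  have "finite {ms \<in> ?A. fps_nth (qmzv_term ns ms) n \<noteq> 0}" for n
  proof (rule finite_subset)
    show "{ms \<in> ?A. fps_nth (qmzv_term ns ms) n \<noteq> 0} \<subseteq>
        {ms. set ms \<subseteq> {..n} \<and> length ms = length ns}"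
    proof safe
      fix ms m
      assume ms: "ms \<in> ?A" and nz: "fps_nth (qmzv_term ns ms) n \<noteq> 0" and m: "m \<in> set ms"
      let ?D = "\<Prod>i<length ns. (1 - fps_X ^ (ms ! i) :: rat fps) powi (ns ! i)"
      have "fps_nth ?D 0 = 1"
        by (rule qmzv_denom_nth_0) (use ms in \<open>auto simp: mzv_indices_def\<close>)
      then have "qmzv_term ns ms = fps_X ^ hd ms * inverse ?D"
        unfolding qmzv_term_def by (intro fps_divide_unit) simp
      then have "hd ms \<le> n"
        using nz by (auto simp: fps_X_power_mult_nth split: if_splits)
      moreover have "m \<le> hd ms"
        using ms m by (cases ms) (auto simp: mzv_indices_def)
      ultimately show "m \<le> n" by simp
    qed (simp add: mzv_indices_def)
    show "finite {ms. set ms \<subseteq> {..n} \<and> length ms = length ns}"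
      by (rule finite_lists_length_eq) simp
  qed
  then have "(qmzv_term ns has_sum
      Abs_fps (\<lambda>n. \<Sum>ms | ms \<in> ?A \<and> fps_nth (qmzv_term ns ms) n \<noteq> 0.
        fps_nth (qmzv_term ns ms) n)) ?A"
    by (intro has_sum_fpsI) simp_all
  then show ?thesis
    by (auto simp: summable_on_def)
qed

end

theory Submission
  imports Defs
begin

text \<open>
  Commutativity and associativity are transported from the quasi-shuffle product along the
  injective operator \<open>T_op\<close>. For the product formula, truncate at \<open>m\<^sub>1 \<le> M\<close>: the multiple
  harmonic sums \<open>hsum M\<close> without the numerator \<open>q\<close>-power are multiplicative for the quasi-shuffle
  product, and \<open>q\<^sup>m / (1 - q\<^sup>m)\<^sup>n = 1 / (1 - q\<^sup>m)\<^sup>n - 1 / (1 - q\<^sup>m)\<^sup>n\<^sup>-\<^sup>1\<close> says that the truncated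
  value of \<open>w\<close> is \<open>hsum M\<close> of \<open>T_op w\<close>. The coefficient of \<open>q\<^sup>j\<close> is not affected by truncation
  at \<open>M \<ge> j\<close>.
\<close>

section \<open>Commutativity and associativity\<close>

lemma lin_wd [simp]: "lin wd x = x"
proof (rule poly_mapping_eqI)
  fix w
  have "Poly_Mapping.lookup (lin wd x) w =
      (\<Sum>u\<in>Poly_Mapping.keys x. if u = w then Poly_Mapping.lookup x u else 0)"
    unfolding lookup_lin by (rule sum.cong) (auto simp: lookup_single)
  also have "\<dots> = Poly_Mapping.lookup x w"
    by (subst sum.delta) (auto simp: in_keys_iff)
  finally show "Poly_Mapping.lookup (lin wd x) w = Poly_Mapping.lookup x w" .
qed

lemma bilin_add_left: "bilin f (x + x') y = bilin f x y + bilin f x' y"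
  by (simp add: bilin_def lin_add)

lemma bilin_add_right: "bilin f x (y + y') = bilin f x y + bilin f x y'"
  unfolding bilin_def lin_swap[where h = f and x = x] by (rule lin_add)

lemmas qsh_add = bilin_add_left[of qsh_word, folded qsh_def]
  bilin_add_right[of qsh_word, folded qsh_def]

lemma prep_add: "prep n (x + y) = prep n x + prep n y"
  by (simp add: prep_def lin_add)

lemma lin_eq_add: "lin (\<lambda>w. f w + g w) x = lin f x + lin g x"
  by (rule poly_mapping_eqI) (simp add: lookup_lin lookup_add distrib_left sum.distrib)

lemma lin_prep: "lin f (prep n x) = lin (\<lambda>w. f (n # w)) x"
  by (simp add: prep_def lin_lin)

lemma prep_lin: "prep n (lin f x) = lin (\<lambda>w. prep n (f w)) x"
  by (simp add: prep_def lin_lin)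

text \<open>The recursion for arbitrary vectors in place of words: in an iterated product the inner
  factor is no longer a word.\<close>

lemma qsh_prep_prep:
  "qsh (prep a x) (prep b y) =
    prep a (qsh x (prep b y)) + prep b (qsh (prep a x) y) + prep (a + b) (qsh x y)"
  by (simp add: qsh_def bilin_def lin_prep prep_lin lin_eq_add)

lemma prep_wd [simp]: "prep n (wd w) = wd (n # w)"
  by (simp add: prep_def)

lemma qsh_word_commute: "qsh_word u v = qsh_word v u"
  by (induction u v rule: qsh_word.induct) (simp_all add: add_ac)

lemma qsh_commute: "qsh x y = qsh y x"
  unfolding qsh_def bilin_def
  by (subst lin_swap) (simp add: qsh_word_commute)

lemma qsh_Nil [simp]: "qsh (wd []) x = x" "qsh x (wd []) = x"
proof -
  have "qsh_word [] = wd"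
    by (simp add: fun_eq_iff)
  then show "qsh (wd []) x = x"
    by (simp add: qsh_def bilin_def)
  then show "qsh x (wd []) = x"
    by (simp add: qsh_commute)
qed

text \<open>Both bracketings expand into the same seven terms, one for each nonempty set of the
  first letters \<open>a\<close>, \<open>b\<close>, \<open>c\<close> that merge into the leading
  letter. The remaining triples are shorter in total, so induction on the sum of the lengths
  applies.\<close>

lemma qsh_word_assoc: "qsh (qsh_word u v) (wd w) = qsh (wd u) (qsh_word v w)"
proof (induction "length u + length v + length w" arbitrary: u v w rule: less_induct)
  case less
  show ?case
  proof (cases "u = [] \<or> v = [] \<or> w = []")
    case True
    then show ?thesis by auto
  next
    case False
    then obtain a u' b v' c w' where eq: "u = a # u'" "v = b # v'" "w = c # w'"
      by (meson neq_Nil_conv)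
    let ?L = "\<lambda>u v w. qsh (qsh_word u v) (wd w)"
    let ?R = "\<lambda>u v w. qsh (wd u) (qsh_word v w)"
    \<comment> \<open>Each of the three terms of \<open>qsh_word u v\<close> contributes one product
      led by \<open>c\<close> alone; these three recombine into
      \<open>prep c (?L u v w')\<close>.\<close>
    have "?L u v w =
        prep a (?L u' v w) + prep b (?L u v' w) + prep c (?L u v w')
        + prep (a + b) (?L u' v' w) + prep (a + c) (?L u' v w') + prep (b + c) (?L u v' w')
        + prep (a + b + c) (?L u' v' w')"
      using qsh_prep_prep[where b = c and y = "wd w'"]
      by (simp add: eq qsh_add prep_add)
    also have "\<dots> =
        prep a (?R u' v w) + prep b (?R u v' w) + prep c (?R u v w')
        + prep (a + b) (?R u' v' w) + prep (a + c) (?R u' v w') + prep (b + c) (?R u v' w')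
        + prep (a + b + c) (?R u' v' w')"
      \<comment> \<open>The inner products must stay folded to match the induction
        hypothesis.\<close>
      by (simp add: less eq del: qsh_word.simps)
    also have "\<dots> = ?R u v w"
      using qsh_prep_prep[where a = a and x = "wd u'"]
      by (simp add: eq qsh_add prep_add add.assoc)
    finally show ?thesis .
  qed
qed

lemma qsh_lin_left: "qsh (lin f x) y = lin (\<lambda>u. qsh (f u) y) x"
  by (simp add: qsh_def bilin_def lin_lin)

lemma qsh_lin_right: "qsh x (lin f y) = lin (\<lambda>v. qsh x (f v)) y"
  by (simp add: qsh_commute[of x] qsh_lin_left)

lemma qsh_assoc: "qsh (qsh x y) z = qsh x (qsh y z)"
proof -
  have "qsh (qsh x y) z = lin (\<lambda>u. lin (\<lambda>v. lin (\<lambda>w. qsh (qsh (wd u) (wd v)) (wd w)) z) y) x"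
    \<comment> \<open>Read from right to left: pulling each \<open>lin\<close> back into its
      argument leaves \<open>lin wd x\<close>, which is \<open>x\<close>.\<close>
    by (simp add: qsh_lin_left[symmetric] qsh_lin_right[symmetric] del: qsh_wd)
  also have "\<dots> = lin (\<lambda>u. lin (\<lambda>v. lin (\<lambda>w. qsh (wd u) (qsh (wd v) (wd w))) z) y) x"
    by (simp add: qsh_word_assoc)
  also have "\<dots> = qsh x (qsh y z)"
    by (simp add: qsh_lin_left[symmetric] qsh_lin_right[symmetric] del: qsh_wd)
  finally show ?thesis .
qed

lemma qqsh_commute: "x \<star> y = y \<star> x"
  by (rule injD[OF inj_T_op]) (simp add: T_op_qqsh qsh_commute)

lemma qqsh_assoc: "(x \<star> y) \<star> z = x \<star> (y \<star> z)"
  by (rule injD[OF inj_T_op]) (simp add: T_op_qqsh qsh_assoc)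

section \<open>Linear extension of power-series valued maps\<close>

text \<open>Kept generic so that \<open>qmzv_qs\<close> and the linear extension of
  \<open>hsum M\<close> share one set of rules.\<close>

definition lin_fps :: "(zword \<Rightarrow> rat fps) \<Rightarrow> qwords \<Rightarrow> rat fps" where
  "lin_fps f x = (\<Sum>w\<in>Poly_Mapping.keys x. fps_const (Poly_Mapping.lookup x w) * f w)"

lemma lin_fps_superset:
  assumes "finite A" "Poly_Mapping.keys x \<subseteq> A"
  shows "lin_fps f x = (\<Sum>w\<in>A. fps_const (Poly_Mapping.lookup x w) * f w)"
  unfolding lin_fps_def
  by (rule sum.mono_neutral_left) (use assms in \<open>auto simp: in_keys_iff\<close>)

lemma lin_fps_wd [simp]: "lin_fps f (wd w) = f w"
  by (simp add: lin_fps_def)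

lemma lin_fps_zero [simp]: "lin_fps f 0 = 0"
  by (simp add: lin_fps_def)

lemma lin_fps_add: "lin_fps f (x + y) = lin_fps f x + lin_fps f y"
  by (simp add: lin_fps_superset[where A = "Poly_Mapping.keys x \<union> Poly_Mapping.keys y"]
      Poly_Mapping.keys_add lookup_add sum.distrib distrib_right flip: fps_const_add)

lemma lin_fps_diff: "lin_fps f (x - y) = lin_fps f x - lin_fps f y"
  using lin_fps_add[of f "x - y" y] by (simp add: algebra_simps)

lemma lin_fps_sum: "lin_fps f (sum g A) = (\<Sum>a\<in>A. lin_fps f (g a))"
  by (induction A rule: infinite_finite_induct) (simp_all add: lin_fps_add)

lemma lin_fps_scl: "lin_fps f (scl c x) = fps_const c * lin_fps f x"
proof -
  have "Poly_Mapping.keys (scl c x) \<subseteq> Poly_Mapping.keys x"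
    by (auto simp: in_keys_iff lookup_scl)
  then show ?thesis
    by (simp add: lin_fps_superset[where A = "Poly_Mapping.keys x"] lookup_scl
        sum_distrib_left mult.assoc flip: fps_const_mult)
qed

lemma lin_fps_lin: "lin_fps g (lin f x) = lin_fps (\<lambda>w. lin_fps g (f w)) x"
  by (simp add: lin_def lin_fps_sum lin_fps_scl lin_fps_def[of "\<lambda>w. lin_fps g (f w)"])

lemma lin_fps_prep: "lin_fps f (prep n x) = lin_fps (\<lambda>w. f (n # w)) x"
  by (simp add: prep_def lin_fps_lin)

lemma lin_fps_eq_add: "lin_fps (\<lambda>w. f w + g w) x = lin_fps f x + lin_fps g x"
  by (simp add: lin_fps_def distrib_left sum.distrib)

lemma lin_fps_mult_left: "lin_fps (\<lambda>w. c * f w) x = c * lin_fps f x"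
  by (simp add: lin_fps_def sum_distrib_left mult.left_commute)

lemma lin_fps_mult_right: "lin_fps (\<lambda>w. f w * c) x = lin_fps f x * c"
  by (simp add: lin_fps_def sum_distrib_right mult.assoc)

lemma lin_fps_bilin:
  assumes "\<And>u v. lin_fps f (g u v) = f u * f v"
  shows "lin_fps f (bilin g x y) = lin_fps f x * lin_fps f y"
  by (simp add: bilin_def lin_fps_lin assms lin_fps_mult_left lin_fps_mult_right)

lemma fps_nth_lin_fps_cong:
  assumes "\<And>w. fps_nth (f w) j = fps_nth (g w) j"
  shows "fps_nth (lin_fps f x) j = fps_nth (lin_fps g x) j"
  by (simp add: lin_fps_def fps_sum_nth assms)

lemma qmzv_qs_eq_lin_fps: "qmzv_qs = lin_fps qmzv_word"
  by (simp add: fun_eq_iff qmzv_qs_def lin_fps_def)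

section \<open>Truncated multiple harmonic sums\<close>

definition hweight :: "nat \<Rightarrow> int \<Rightarrow> rat fps" where
  "hweight m n = inverse ((1 - fps_X ^ m) powi n)"

text \<open>\<^typ>\<open>rat fps\<close> is not a division ring, so the library's rules for \<open>powi\<close> do not apply.\<close>

lemma power_int_add_of_unit:
  fixes a :: "'a :: {comm_ring_1, inverse}"
  assumes "a * inverse a = 1"
  shows "a powi (m + n) = a powi m * a powi n"
proof -
  have suc: "a powi (k + 1) = a * a powi k" for k
  proof (cases "k \<ge> 0")
    case True
    then show ?thesis by (simp add: power_int_def nat_add_distrib)
  next
    case False
    then have "nat (- k) = Suc (nat (- (k + 1)))" by simp
    then have "a powi k = inverse a * inverse a ^ nat (- (k + 1))"
      using False by (simp only: power_int_def power_Suc if_False)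
    also have "a * \<dots> = inverse a ^ nat (- (k + 1))"
      by (simp add: assms flip: mult.assoc)
    also have "\<dots> = a powi (k + 1)"
      \<comment> \<open>For k = -1 the exponent k + 1 = 0 falls into the nonnegative branch of
        \<open>powi\<close>.\<close>
      using False by (cases "k = -1") (simp_all add: power_int_def)
    finally show ?thesis by simp
  qed
  have pred: "a powi (k - 1) = inverse a * a powi k" for k
    using suc[of "k - 1"] assms by (simp add: mult.commute[of "inverse a"] flip: mult.assoc)
  show ?thesis
  proof (induction m rule: int_induct[where k = 0])
    case (step1 i)
    have "a powi (i + 1 + n) = a * a powi (i + n)"
      using suc[of "i + n"] by (simp add: add_ac)
    then show ?case by (simp add: step1 suc mult.assoc)
  next
    case (step2 i)
    have "a powi (i - 1 + n) = inverse a * a powi (i + n)"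
      using pred[of "i + n"] by (simp add: algebra_simps)
    then show ?case by (simp add: step2 pred mult.assoc)
  qed simp
qed

lemma unit_one_minus_X_power:
  assumes "m > 0"
  shows "(1 - fps_X ^ m :: rat fps) * inverse (1 - fps_X ^ m) = 1"
  using assms by (intro inverse_mult_eq_1') simp

lemma hweight_add:
  assumes "m > 0"
  shows "hweight m (a + b) = hweight m a * hweight m b"
  by (simp add: hweight_def power_int_add_of_unit[OF unit_one_minus_X_power[OF assms]]
      fps_inverse_mult)

text \<open>Lowering the exponent by one multiplies by \<open>hweight m (- 1)\<close>, which is 1 -
  q^m.\<close>

lemma hweight_diff_one:
  assumes "m > 0"
  shows "hweight m n - hweight m (n - 1) = fps_X ^ m * hweight m n"
proof -
  have "hweight m (- 1) = 1 - fps_X ^ m"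
    using assms by (simp add: hweight_def power_int_def)
  then show ?thesis
    using hweight_add[OF assms, of n "- 1"] by (simp add: right_diff_distrib)
qed

text \<open>The sum over M >= m_1 > ... > m_k > 0 of the products of the weights (see
  \<open>hsum_eq_sum\<close>), split according to whether m_1 attains the bound. This form allows
  induction on the bound.\<close>

fun hsum :: "nat \<Rightarrow> zword \<Rightarrow> rat fps" where
  "hsum M [] = 1"
| "hsum 0 (n # w) = 0"
| "hsum (Suc M) (n # w) = hsum M (n # w) + hweight (Suc M) n * hsum M w"

lemma lin_fps_hsum_prep_0: "lin_fps (hsum 0) (prep n x) = 0"
  by (simp add: lin_fps_prep) (simp add: lin_fps_def)

lemma lin_fps_hsum_prep_Suc:
  "lin_fps (hsum (Suc M)) (prep n x) =
    lin_fps (hsum M) (prep n x) + hweight (Suc M) n * lin_fps (hsum M) x"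
  by (simp add: lin_fps_prep lin_fps_eq_add lin_fps_mult_left)

text \<open>When the bound grows to M + 1, the new index is taken by the first letter of
  \<open>u\<close>, of \<open>v\<close>, of both or of neither. If both take it, their weights
  multiply to that of the merged letter \<open>a + b\<close> by \<open>hweight_add\<close>.\<close>

lemma hsum_qsh_word: "lin_fps (hsum M) (qsh_word u v) = hsum M u * hsum M v"
proof (induction M arbitrary: u v)
  case 0
  show ?case
    by (cases u; cases v) (simp_all add: lin_fps_add lin_fps_hsum_prep_0)
next
  case (Suc M)
  show ?case
  proof (cases u; cases v)
    fix a u' b v' assume uv: "u = a # u'" "v = b # v'"
    let ?h = "hsum M" and ?e = "hweight (Suc M)"
    have "lin_fps (hsum (Suc M)) (qsh_word u v) = lin_fps ?h (qsh_word u v)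
        + ?e a * lin_fps ?h (qsh_word u' v) + ?e b * lin_fps ?h (qsh_word u v')
        + ?e (a + b) * lin_fps ?h (qsh_word u' v')"
      by (simp add: uv lin_fps_add lin_fps_hsum_prep_Suc del: hsum.simps)
    also have "\<dots> = hsum (Suc M) u * hsum (Suc M) v"
      unfolding Suc hweight_add[OF zero_less_Suc] by (simp add: uv algebra_simps)
    finally show ?thesis .
  qed simp_all
qed

lemma hsum_qsh: "lin_fps (hsum M) (qsh x y) = lin_fps (hsum M) x * lin_fps (hsum M) y"
  unfolding qsh_def by (rule lin_fps_bilin) (rule hsum_qsh_word)

section \<open>Comparison with the q-multiple zeta values\<close>

definition bounded_indices :: "nat \<Rightarrow> nat \<Rightarrow> nat list set" where
  "bounded_indices k M = {ms \<in> mzv_indices k. set ms \<subseteq> {..M}}"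

lemma finite_bounded_indices: "finite (bounded_indices k M)"
  by (rule finite_subset[OF _ finite_lists_length_eq[of "{..M}" k]])
    (auto simp: bounded_indices_def mzv_indices_def)

lemma bounded_indices_zero: "bounded_indices 0 M = {[]}"
  by (auto simp: bounded_indices_def mzv_indices_def)

lemma bounded_indices_Suc_0: "bounded_indices (Suc k) 0 = {}"
  by (auto simp: bounded_indices_def mzv_indices_def length_Suc_conv)

text \<open>The set-level counterpart of the recursion of \<open>hsum\<close>: the largest index is
  either at most M or equal to M + 1.\<close>

lemma bounded_indices_Suc_Suc:
  "bounded_indices (Suc k) (Suc M) =
    bounded_indices (Suc k) M \<union> (#) (Suc M) ` bounded_indices k M"
proof (intro equalityI subsetI)
  fix ms assume "ms \<in> bounded_indices (Suc k) (Suc M)"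
  then obtain m ms' where ms: "ms = m # ms'" "length ms' = k" "sorted_wrt (>) ms'"
      "\<forall>i\<in>set ms'. 0 < i \<and> i < m" "0 < m" "m \<le> Suc M"
    by (auto simp: bounded_indices_def mzv_indices_def length_Suc_conv)
  then show "ms \<in> bounded_indices (Suc k) M \<union> (#) (Suc M) ` bounded_indices k M"
    by (cases "m = Suc M") (fastforce simp: bounded_indices_def mzv_indices_def)+
qed (fastforce simp: bounded_indices_def mzv_indices_def)

definition hprod :: "int list \<Rightarrow> nat list \<Rightarrow> rat fps" where
  "hprod ns ms = (\<Prod>i<length ns. hweight (ms ! i) (ns ! i))"

lemma hprod_Cons: "hprod (n # ns) (m # ms) = hweight m n * hprod ns ms"
  by (simp add: hprod_def prod.lessThan_Suc_shift del: prod.lessThan_Suc)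

lemma hsum_eq_sum: "hsum M w = (\<Sum>ms\<in>bounded_indices (length w) M. hprod w ms)"
proof (induction M w rule: hsum.induct)
  case (3 M n w)
  have disj: "bounded_indices (Suc (length w)) M \<inter> (#) (Suc M) ` bounded_indices (length w) M = {}"
    by (auto simp: bounded_indices_def)
  have "(\<Sum>ms\<in>bounded_indices (length (n # w)) (Suc M). hprod (n # w) ms) =
      hsum M (n # w) + (\<Sum>ms\<in>(#) (Suc M) ` bounded_indices (length w) M. hprod (n # w) ms)"
    using disj
    by (simp add: 3(1) bounded_indices_Suc_Suc sum.union_disjoint finite_bounded_indices)
  also have "(\<Sum>ms\<in>(#) (Suc M) ` bounded_indices (length w) M. hprod (n # w) ms) =
      hweight (Suc M) n * hsum M w"
    by (simp add: 3(2) sum.reindex hprod_Cons sum_distrib_left)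
  finally show ?case by simp
qed (simp_all add: bounded_indices_zero bounded_indices_Suc_0 hprod_def)

text \<open>The denominator has constant coefficient 1, so dividing by it is multiplying by its
  inverse.\<close>

lemma qmzv_term_eq_hprod:
  assumes "ms \<in> mzv_indices (length ns)"
  shows "qmzv_term ns ms = fps_X ^ hd ms * hprod ns ms"
proof -
  let ?D = "\<Prod>i<length ns. (1 - fps_X ^ (ms ! i) :: rat fps) powi (ns ! i)"
  have "fps_nth ?D 0 = 1"
    by (rule qmzv_denom_nth_0) (use assms in \<open>auto simp: mzv_indices_def\<close>)
  then have "qmzv_term ns ms = fps_X ^ hd ms * inverse ?D"
    unfolding qmzv_term_def by (intro fps_divide_unit) simp
  moreover have "inverse (prod f A) = (\<Prod>i\<in>A. inverse (f i))"
    for f :: "nat \<Rightarrow> rat fps" and A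
    by (induction A rule: infinite_finite_induct) (simp_all add: fps_inverse_mult)
  ultimately show ?thesis
    by (simp add: hprod_def hweight_def)
qed

text \<open>\<open>T_word\<close> alters only the first letter, hence only the weight at the largest
  index m_1, where \<open>hweight_diff_one\<close> produces the numerator q^(m_1).\<close>

lemma lin_fps_hsum_T_word:
  "lin_fps (hsum M) (T_word (n # w)) =
    (\<Sum>ms\<in>bounded_indices (length (n # w)) M. qmzv_term (n # w) ms)"
proof -
  have "hprod (n # w) ms - hprod ((n - 1) # w) ms = qmzv_term (n # w) ms"
    if ms: "ms \<in> bounded_indices (length (n # w)) M" for ms
  proof -
    obtain m ms' where m: "ms = m # ms'" "m > 0"
      using ms by (auto simp: bounded_indices_def mzv_indices_def length_Suc_conv)
    have "qmzv_term (n # w) ms = fps_X ^ hd ms * hprod (n # w) ms"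
      using ms by (intro qmzv_term_eq_hprod) (auto simp: bounded_indices_def)
    then show ?thesis
      by (simp add: m hprod_Cons hweight_diff_one flip: left_diff_distrib mult.assoc)
  qed
  then show ?thesis
    by (simp add: lin_fps_diff hsum_eq_sum flip: sum_subtractf)
qed

text \<open>Each term is divisible by q^(m_1), so only tuples with m_1 <= j reach the coefficient of
  q^j.\<close>

lemma fps_nth_qmzv:
  assumes "ns \<noteq> []" "j \<le> M"
  shows "fps_nth (qmzv ns) j = fps_nth (\<Sum>ms\<in>bounded_indices (length ns) M. qmzv_term ns ms) j"
proof -
  let ?A = "mzv_indices (length ns)"
  let ?S = "\<lambda>n. {ms \<in> ?A. fps_nth (qmzv_term ns ms) n \<noteq> 0}"
  \<comment> \<open>Serves twice: for the finiteness of every \<open>?S n\<close>, which gives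
    q-adic convergence, and for the comparison with the truncation at M.\<close>
  have sub: "?S n \<subseteq> bounded_indices (length ns) N" if "n \<le> N" for n N
  proof
    fix ms assume ms: "ms \<in> ?S n"
    then have "hd ms \<le> n"
      by (auto simp: qmzv_term_eq_hprod fps_X_power_mult_nth split: if_splits)
    moreover have "m \<le> hd ms" if "m \<in> set ms" for m
      using that ms by (cases ms) (auto simp: mzv_indices_def)
    ultimately show "ms \<in> bounded_indices (length ns) N"
      using ms that by (fastforce simp: bounded_indices_def)
  qed
  then have "finite (?S n)" for n
    using finite_subset[OF _ finite_bounded_indices] by blast
  then have "(qmzv_term ns has_sum Abs_fps (\<lambda>n. \<Sum>ms\<in>?S n. fps_nth (qmzv_term ns ms) n)) ?A"
    by (intro has_sum_fpsI) simp_all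
  then have "qmzv ns = Abs_fps (\<lambda>n. \<Sum>ms\<in>?S n. fps_nth (qmzv_term ns ms) n)"
    unfolding qmzv_def by (rule infsumI)
  then have "fps_nth (qmzv ns) j = (\<Sum>ms\<in>?S j. fps_nth (qmzv_term ns ms) j)"
    by simp
  also have "\<dots> = (\<Sum>ms\<in>bounded_indices (length ns) M. fps_nth (qmzv_term ns ms) j)"
    using sub[OF assms(2)]
    by (intro sum.mono_neutral_left finite_bounded_indices) (auto simp: bounded_indices_def)
  finally show ?thesis by (simp add: fps_sum_nth)
qed

lemma fps_nth_qmzv_word:
  assumes "j \<le> M"
  shows "fps_nth (qmzv_word w) j = fps_nth (lin_fps (hsum M) (T_word w)) j"
  using assms
  by (cases w) (simp_all add: qmzv_word_def lin_fps_hsum_T_word fps_nth_qmzv del: T_word.simps(2))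

lemma fps_nth_qmzv_qs:
  assumes "j \<le> M"
  shows "fps_nth (qmzv_qs x) j = fps_nth (lin_fps (hsum M) (T_op x)) j"
  unfolding qmzv_qs_eq_lin_fps T_op_def lin_fps_lin
  by (intro fps_nth_lin_fps_cong fps_nth_qmzv_word assms)

lemma qmzv_qs_qqsh: "qmzv_qs (x \<star> y) = qmzv_qs x * qmzv_qs y"
proof (rule fps_ext)
  fix j
  let ?h = "\<lambda>x. lin_fps (hsum j) (T_op x)"
  have "fps_nth (qmzv_qs (x \<star> y)) j = fps_nth (?h x * ?h y) j"
    by (simp add: fps_nth_qmzv_qs[OF order.refl] T_op_qqsh hsum_qsh)
  \<comment> \<open>The Cauchy product involves only coefficients of index at most j, and truncation
    at j leaves all of these unchanged.\<close>
  also have "\<dots> = fps_nth (qmzv_qs x * qmzv_qs y) j"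
    unfolding fps_mult_nth
    by (intro sum.cong refl arg_cong2[where f = "(*)"] fps_nth_qmzv_qs[symmetric]) auto
  finally show "fps_nth (qmzv_qs (x \<star> y)) j = fps_nth (qmzv_qs x * qmzv_qs y) j" .
qed

theorem proposition9:
  shows "(\<forall>x y :: qwords. x \<star> y = y \<star> x)
    \<and> (\<forall>x y z :: qwords. (x \<star> y) \<star> z = x \<star> (y \<star> z))
    \<and> (\<forall>u v :: zword. qmzv_qs (wd u) * qmzv_qs (wd v) = qmzv_qs (wd u \<star> wd v))"
  using qqsh_commute qqsh_assoc qmzv_qs_qqsh by metis

end
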